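(* Let $(\bar x,\bar\lambda)\in\mathbb{R}^n\times\mathbb{R}^{m+1}$ be a solution to the KKT system $$\nabla f(x)+\nabla\Phi(x)^*\lambda=0,\qquad \lambda\in N_{\mathcal Q}(\Phi(x)).$$ Then the following assertions are equivalent: (i) The second-order sufficient condition holds at $(\bar x,\bar\lambda)$: $$\big\langle\nabla^2_{xx}L(\bar x,\bar\lambda)w,w\big\rangle+\mathrm{d}^2\delta_{\mathcal Q}\big(\Phi(\bar x),\bar\lambda\big)\big(\nabla\Phi(\bar x)w\big)>0\ \text{ for all }w\in\mathbb{R}^n\setminus\{0\}\text{ with }\nabla\Phi(\bar x)w\in K_{\mathcal Q}\big(\Phi(\bar x),\bar\lambda\big).$$ (ii) There exists a constant $\rho_{\bar\lambda}>0$ such that for any $\rho\ge\rho_{\bar\lambda}$ we have $$\mathrm{d}^2_x\mathscr{L}\big((\bar x,\bar\lambda,\rho),0\big)(w)>0\quad\text{whenever }w\in\mathbb{R}^n\setminus\{0\}.$$ (iii) There exist positive constants $\rho_{\bar\lambda},\gamma_{\bar\lambda},\ell_{\bar\lambda}$ such that for any $\rho\ge\rho_{\bar\lambda}$ we have $$\mathscr{L}(x,\bar\lambda,\rho)\ge f(\bar x)+\ell_{\bar\lambda}\|x-\bar x\|^2\quad\text{for all }x\in\mathbb{B}_{\gamma_{\bar\lambda}}(\bar x).$$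
   Context: Setting: the second-order cone program "minimize $f(x)$ subject to $\Phi(x)\in\mathcal Q$", where $f:\mathbb{R}^n\to\mathbb{R}$ and $\Phi:\mathbb{R}^n\to\mathbb{R}^{m+1}$ are twice continuously differentiable around the reference point $\bar x$, and $\mathcal Q:=\{y=(y_0,y_r)\in\mathbb{R}\times\mathbb{R}^m\mid\|y_r\|\le y_0\}$. $\mathbb{B}_\gamma(z)$ is the closed ball of radius $\gamma$ centered at $z$; $A^*$ is the transpose of $A$. The Lagrangian is $L(x,\lambda):=f(x)+\langle\lambda,\Phi(x)\rangle$, and the augmented Lagrangian is $$\mathscr{L}(x,\lambda,\rho):=f(x)+\tfrac{\rho}{2}\mathrm{dist}^2\big(\Phi(x)+\rho^{-1}\lambda;\mathcal Q\big)-\tfrac12\rho^{-1}\|\lambda\|^2,\quad(x,\lambda,\rho)\in\mathbb{R}^n\times\mathbb{R}^{m+1}\times(0,\infty).$$ $T_{\mathcal Q}$, $N_{\mathcal Q}$ are the tangent cone and the convex-analysis normal cone to $\mathcal Q$; for $y\in\mathcal Q$, $v\in N_{\mathcal Q}(y)$ the critical cone is $K_{\mathcal Q}(y,v):=T_{\mathcal Q}(y)\cap\{v\}^\perp$. $\delta_{\mathcal Q}$ is the indicator function of $\mathcal Q$. For $\varphi:\mathbb{R}^p\to(-\infty,\infty]$ with $\varphi(\bar z)$ finite and $\bar v\in\mathbb{R}^p$, the second subderivative of $\varphi$ at $\bar z$ for $\bar v$ is $$\mathrm{d}^2\varphi(\bar z,\bar v)(w):=\liminf_{t\downarrow0,\;w'\to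 w}\frac{\varphi(\bar z+tw')-\varphi(\bar z)-t\langle\bar v,w'\rangle}{\tfrac12t^2}.$$ $\mathrm{d}^2_x\mathscr{L}((\bar x,\bar\lambda,\rho),0)$ denotes the second subderivative of the function $x\mapsto\mathscr{L}(x,\bar\lambda,\rho)$ at $\bar x$ for $0$. *)

theory Defs
  imports "HOL-Analysis.Analysis"
begin

definition C2_around :: "('a::real_normed_vector \<Rightarrow> 'b::real_normed_vector) \<Rightarrow> 'a \<Rightarrow> bool" where
  "C2_around f x \<longleftrightarrow>
    (\<exists>U (f' :: 'a \<Rightarrow> 'a \<Rightarrow>\<^sub>L 'b) (f'' :: 'a \<Rightarrow> 'a \<Rightarrow>\<^sub>L ('a \<Rightarrow>\<^sub>L 'b)).
      open U \<and> x \<in> U \<and>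
      (\<forall>y\<in>U. (f has_derivative blinfun_apply (f' y)) (at y)) \<and>
      (\<forall>y\<in>U. (f' has_derivative blinfun_apply (f'' y)) (at y)) \<and>
      continuous_on U f'')"

text \<open>The gradient and the Hessian operator are meaningful only where the relevant derivatives
  exist; elsewhere their values are unspecified.\<close>

definition gradient :: "('a::real_inner \<Rightarrow> real) \<Rightarrow> 'a \<Rightarrow> 'a" where
  "gradient f x = (THE D. GDERIV f x :> D)"

definition hessian :: "('a::real_inner \<Rightarrow> real) \<Rightarrow> 'a \<Rightarrow> 'a \<Rightarrow> 'a" where
  "hessian f x = frechet_derivative (gradient f) (at x)"

text \<open>The space \<open>\<real>\<^sup>m\<^sup>+\<^sup>1\<close> is \<open>\<real> \<times> \<real>\<^sup>m\<close>; the library's norm and inner product on the product type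
  are the Euclidean ones.\<close>

definition second_order_cone :: "(real \<times> (real ^ 'm)) set" where
  "second_order_cone = {(y0, yr). norm yr \<le> y0}"

text \<open>The contingent (Bouligand) tangent cone.\<close>

definition tangent_cone :: "'a::real_normed_vector set \<Rightarrow> 'a \<Rightarrow> 'a set" where
  "tangent_cone \<Omega> y = {w. y \<in> \<Omega> \<and>
    (\<exists>(t :: nat \<Rightarrow> real) (u :: nat \<Rightarrow> 'a). (\<forall>k. t k > 0) \<and> t \<longlonglongrightarrow> 0 \<and> u \<longlonglongrightarrow> w \<and>
      (\<forall>k. y + t k *\<^sub>R u k \<in> \<Omega>))}"

definition normal_cone :: "'a::real_inner set \<Rightarrow> 'a \<Rightarrow> 'a set" where
  "normal_cone \<Omega> y = {v. y \<in> \<Omega> \<and> (\<forall>z\<in>\<Omega>. v \<bullet> (z - y) \<le> 0)}"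

definition critical_cone :: "'a::real_inner set \<Rightarrow> 'a \<Rightarrow> 'a \<Rightarrow> 'a set" where
  "critical_cone \<Omega> y v = tangent_cone \<Omega> y \<inter> {u. v \<bullet> u = 0}"

definition ind_fun :: "'a set \<Rightarrow> 'a \<Rightarrow> ereal" where
  "ind_fun \<Omega> y = (if y \<in> \<Omega> then 0 else \<infinity>)"

text \<open>Intended for \<open>\<phi>\<close> with values in \<open>(-\<infinity>, \<infinity>]\<close> and \<open>\<phi> z\<close> finite. The lower limit
  allows \<open>w' = w\<close>, hence \<^term>\<open>nhds w\<close> rather than a punctured neighbourhood filter.\<close>

definition second_subderivative :: "('a::real_inner \<Rightarrow> ereal) \<Rightarrow> 'a \<Rightarrow> 'a \<Rightarrow> 'a \<Rightarrow> ereal" where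
  "second_subderivative \<phi> z v w =
    Liminf (at_right 0 \<times>\<^sub>F nhds w)
      (\<lambda>(t::real, w'). (\<phi> (z + t *\<^sub>R w') - \<phi> z - ereal (t * (v \<bullet> w'))) / ereal (t\<^sup>2 / 2))"

definition lagrangian ::
  "('a \<Rightarrow> real) \<Rightarrow> ('a \<Rightarrow> 'b::real_inner) \<Rightarrow> 'a \<Rightarrow> 'b \<Rightarrow> real" where
  "lagrangian f \<Phi> x \<mu> = f x + \<mu> \<bullet> \<Phi> x"

definition aug_lagrangian ::
  "('a \<Rightarrow> real) \<Rightarrow> ('a \<Rightarrow> real \<times> (real ^ 'm)) \<Rightarrow> 'a \<Rightarrow> real \<times> (real ^ 'm) \<Rightarrow> real \<Rightarrow> real" where
  "aug_lagrangian f \<Phi> x \<mu> \<rho> =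
    f x + \<rho> / 2 * (infdist (\<Phi> x + inverse \<rho> *\<^sub>R \<mu>) second_order_cone)\<^sup>2
      - 1 / 2 * inverse \<rho> * (norm \<mu>)\<^sup>2"

end

theory Submission
  imports Defs
begin

text \<open>Completing the square turns the augmented Lagrangian into
  \<open>min {L(x, \<mu>) - \<langle>\<mu>, z\<rangle> + \<rho>/2 \<parallel>\<Phi> x - z\<parallel>\<^sup>2 | z \<in> Q}\<close>, which equals \<open>f x\<close> at a KKT point and is
  nondecreasing in \<open>\<rho>\<close>. A function grows quadratically at \<open>x\<close> iff its second subderivative there
  for \<open>0\<close> is positive off the origin (compactness of the sphere), so monotonicity gives the
  equivalence of (ii) and (iii). Taking \<open>z = \<Phi> x + t u\<close> in the minimum at \<open>x + t w\<close>
  with \<open>u \<rightarrow> \<nabla>\<Phi>(x) w\<close> bounds the difference quotients of the indicator function from below,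
  hence (iii) implies (i). If (iii) fails, there are violating points \<open>x + t\<^sub>k v\<^sub>k\<close> with
  \<open>\<rho>\<^sub>k \<rightarrow> \<infinity>\<close>; the minimisers \<open>z\<^sub>k = \<Phi> x + t\<^sub>k u\<^sub>k\<close> then satisfy \<open>u\<^sub>k \<rightarrow> \<nabla>\<Phi>(x) w\<close>, so
  the limit direction \<open>w\<close> is critical and contradicts (i).\<close>

section \<open>C2 functions, gradients and their representation\<close>

lemma C2_around_add:
  fixes f g :: "'a::real_normed_vector \<Rightarrow> 'b::real_normed_vector"
  assumes "C2_around f x" "C2_around g x"
  shows "C2_around (\<lambda>y. f y + g y) x"
proof -
  obtain U f' f'' where f: "open U" "x \<in> U"
      "\<And>y. y \<in> U \<Longrightarrow> (f has_derivative blinfun_apply (f' y)) (at y)"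
      "\<And>y. y \<in> U \<Longrightarrow> (f' has_derivative blinfun_apply (f'' y)) (at y)"
      "continuous_on U f''"
    using assms(1) unfolding C2_around_def by blast
  obtain V g' g'' where g: "open V" "x \<in> V"
      "\<And>y. y \<in> V \<Longrightarrow> (g has_derivative blinfun_apply (g' y)) (at y)"
      "\<And>y. y \<in> V \<Longrightarrow> (g' has_derivative blinfun_apply (g'' y)) (at y)"
      "continuous_on V g''"
    using assms(2) unfolding C2_around_def by blast
  have "((\<lambda>y. f y + g y) has_derivative blinfun_apply (f' y + g' y)) (at y)"
    if "y \<in> U \<inter> V" for y
    using has_derivative_add[OF f(3) g(3), of y] that by (simp add: plus_blinfun.rep_eq)
  moreover have "((\<lambda>y. f' y + g' y) has_derivative blinfun_apply (f'' y + g'' y)) (at y)"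
    if "y \<in> U \<inter> V" for y
    using has_derivative_add[OF f(4) g(4), of y] that by (simp add: plus_blinfun.rep_eq)
  moreover have "continuous_on (U \<inter> V) (\<lambda>y. f'' y + g'' y)"
    using f(5) g(5) by (intro continuous_on_add) (auto intro: continuous_on_subset)
  ultimately show ?thesis
    unfolding C2_around_def using f(1,2) g(1,2)
    by (intro exI[of _ "U \<inter> V"] exI[of _ "\<lambda>y. f' y + g' y"] exI[of _ "\<lambda>y. f'' y + g'' y"]) auto
qed

lemma C2_around_bounded_linear:
  fixes f :: "'a::real_normed_vector \<Rightarrow> 'b::real_normed_vector"
    and h :: "'b \<Rightarrow> 'c::real_normed_vector"
  assumes "bounded_linear h" "C2_around f x"
  shows "C2_around (\<lambda>y. h (f y)) x"
proof -
  obtain U f' f'' where f: "open U" "x \<in> U"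
      "\<And>y. y \<in> U \<Longrightarrow> (f has_derivative blinfun_apply (f' y)) (at y)"
      "\<And>y. y \<in> U \<Longrightarrow> (f' has_derivative blinfun_apply (f'' y)) (at y)"
      "continuous_on U f''"
    using assms(2) unfolding C2_around_def by blast
  define H where "H = Blinfun h"
  have H: "blinfun_apply H = h"
    unfolding H_def using assms(1) by (simp add: bounded_linear_Blinfun_apply)
  \<comment> \<open>Left composition with \<open>H\<close> is itself bounded linear between the
    spaces of first derivatives, so the chain rule for a linear outer map applies a second time, now
    to \<open>f'\<close>.\<close>
  define C where "C = (Blinfun ((o\<^sub>L) H) :: ('a \<Rightarrow>\<^sub>L 'b) \<Rightarrow>\<^sub>L ('a \<Rightarrow>\<^sub>L 'c))"
  have C: "blinfun_apply C = (o\<^sub>L) H"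
    unfolding C_def
    by (simp add: bounded_linear_Blinfun_apply bounded_bilinear.bounded_linear_right
        bounded_bilinear_blinfun_compose)
  have "((\<lambda>y. h (f y)) has_derivative blinfun_apply (H o\<^sub>L f' y)) (at y)" if "y \<in> U" for y
    using bounded_linear.has_derivative[OF assms(1) f(3)[OF that]]
    by (simp add: H blinfun_compose.rep_eq o_def)
  moreover have "((\<lambda>y. H o\<^sub>L f' y) has_derivative blinfun_apply (C o\<^sub>L f'' y)) (at y)"
    if "y \<in> U" for y
    using bounded_linear.has_derivative[OF blinfun.bounded_linear_right f(4)[OF that], of C]
    by (simp add: C blinfun_compose.rep_eq o_def)
  moreover have "continuous_on U (\<lambda>y. C o\<^sub>L f'' y)"
    by (intro bounded_bilinear.continuous_on[OF bounded_bilinear_blinfun_compose]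
        continuous_on_const f(5))
  ultimately show ?thesis
    unfolding C2_around_def using f(1,2)
    by (intro exI[of _ U] exI[of _ "\<lambda>y. H o\<^sub>L f' y"] exI[of _ "\<lambda>y. C o\<^sub>L f'' y"]) auto
qed

lemma C2_around_lagrangian:
  assumes "C2_around f x" "C2_around \<Phi> x"
  shows "C2_around (\<lambda>x. lagrangian f \<Phi> x \<mu>) x"
  unfolding lagrangian_def
  by (intro C2_around_add C2_around_bounded_linear[OF bounded_linear_inner_right] assms)

lemma C2_around_imp_has_derivative:
  assumes "C2_around f x"
  shows "(f has_derivative frechet_derivative f (at x)) (at x)"
  using assms unfolding C2_around_def
  by (metis differentiableI frechet_derivative_works)

text \<open>Riesz representation in coordinates: expand \<open>h\<close> in the basis and use
  linearity of \<open>f'\<close>.\<close>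

lemma has_derivative_imp_gderiv:
  fixes f :: "'a::euclidean_space \<Rightarrow> real"
  assumes "(f has_derivative f') (at x)"
  shows "GDERIV f x :> (\<Sum>b\<in>Basis. f' b *\<^sub>R b)"
proof -
  interpret linear f'
    using assms by (rule has_derivative_linear)
  have "f' h = h \<bullet> (\<Sum>b\<in>Basis. f' b *\<^sub>R b)" for h
  proof -
    have "f' h = f' (\<Sum>b\<in>Basis. (h \<bullet> b) *\<^sub>R b)"
      by (simp add: euclidean_representation)
    also have "\<dots> = h \<bullet> (\<Sum>b\<in>Basis. f' b *\<^sub>R b)"
      by (simp add: sum scale inner_sum_right mult.commute)
    finally show ?thesis .
  qed
  then have "f' = (\<lambda>h. h \<bullet> (\<Sum>b\<in>Basis. f' b *\<^sub>R b))"
    by blast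
  then show ?thesis
    using assms unfolding gderiv_def by metis
qed

lemma gradient_eqI:
  assumes "GDERIV f x :> D"
  shows "gradient f x = D"
  unfolding gradient_def
proof (rule the_equality[where P = "\<lambda>D. GDERIV f x :> D", OF assms])
  fix E assume "GDERIV f x :> E"
  then have "(\<lambda>h. h \<bullet> E) = (\<lambda>h. h \<bullet> D)"
    using assms has_derivative_unique unfolding gderiv_def by blast
  then show "E = D"
    by (metis inner_commute vector_eq_rdot)
qed

section \<open>Taylor expansion and limits of difference quotients\<close>

text \<open>Restrict to the segment from \<open>x\<close> to \<open>x + v\<close>. The Lagrange
  remainder evaluates the second derivative at an intermediate point, and continuity of
  \<open>f''\<close> at \<open>x\<close> makes replacing that point by \<open>x\<close> cost at most
  \<open>e\<close>.\<close>

lemma second_order_taylor: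
  fixes f :: "'a::real_normed_vector \<Rightarrow> real"
  assumes "open U" "x \<in> U"
    and f': "\<And>y. y \<in> U \<Longrightarrow> (f has_derivative blinfun_apply (f' y)) (at y)"
    and f'': "\<And>y. y \<in> U \<Longrightarrow> (f' has_derivative blinfun_apply (f'' y)) (at y)"
    and cont: "continuous_on U f''"
    and "e > 0"
  obtains d where "d > 0"
    "\<And>v. norm v < d \<Longrightarrow> \<bar>f (x + v) - f x - f' x v - f'' x v v / 2\<bar> \<le> e * (norm v)\<^sup>2"
proof -
  have "isCont f'' x"
    using cont assms(1,2) by (simp add: continuous_on_eq_continuous_at)
  then obtain d1 where d1: "d1 > 0" "\<And>y. dist y x < d1 \<Longrightarrow> dist (f'' y) (f'' x) < e"
    using \<open>e > 0\<close> unfolding continuous_at_eps_delta by blast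
  obtain d2 where d2: "d2 > 0" "ball x d2 \<subseteq> U"
    using assms(1,2) openE by blast
  have "\<bar>f (x + v) - f x - f' x v - f'' x v v / 2\<bar> \<le> e * (norm v)\<^sup>2"
    if v: "norm v < min d1 d2" for v
  proof -
    \<comment> \<open>\<open>D m\<close> is the derivative of order \<open>m\<close> of
      \<open>s \<mapsto> f (x + s v)\<close> for \<open>m \<le> 2\<close>, in the indexed form that
      \<open>Maclaurin\<close> expects.\<close>
    define D :: "nat \<Rightarrow> real \<Rightarrow> real" where
      "D m s = (if m = 0 then f (x + s *\<^sub>R v) else if m = 1 then f' (x + s *\<^sub>R v) v
        else f'' (x + s *\<^sub>R v) v v)" for m s
    have short: "norm (s *\<^sub>R v) < min d1 d2" if "0 \<le> s" "s \<le> 1" for s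
      using that v mult_left_le_one_le[of "norm v" s] by simp
    have inU: "x + s *\<^sub>R v \<in> U" if "0 \<le> s" "s \<le> 1" for s
      using short[OF that] d2(2) by (auto simp: dist_norm)
    have D0: "(D 0 has_real_derivative D 1 s) (at s)" if s: "0 \<le> s" "s \<le> 1" for s
    proof -
      have "((\<lambda>s. f (x + s *\<^sub>R v)) has_derivative (*) (f' (x + s *\<^sub>R v) v)) (at s)"
        by (rule has_derivative_eq_rhs, rule has_derivative_compose
            [where g = f and f = "\<lambda>s. x + s *\<^sub>R v", OF _ f'[OF inU[OF s]]])
          (auto intro!: derivative_eq_intros simp: blinfun.scaleR_right)
      then show ?thesis
        unfolding D_def by (simp add: has_field_derivative_def)
    qed
    have D1: "(D 1 has_real_derivative D 2 s) (at s)" if s: "0 \<le> s" "s \<le> 1" for s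
    proof -
      have "((\<lambda>s. f' (x + s *\<^sub>R v)) has_derivative (\<lambda>h. f'' (x + s *\<^sub>R v) (h *\<^sub>R v))) (at s)"
        by (rule has_derivative_compose[where g = f' and f = "\<lambda>s. x + s *\<^sub>R v", OF _ f''[OF inU[OF s]]])
          (auto intro!: derivative_eq_intros)
      then have "((\<lambda>s. f' (x + s *\<^sub>R v) v) has_derivative
          (\<lambda>h. f'' (x + s *\<^sub>R v) (h *\<^sub>R v) v)) (at s)"
        by (rule bounded_linear.has_derivative[OF blinfun.bounded_linear_left])
      moreover have "(\<lambda>h. f'' (x + s *\<^sub>R v) (h *\<^sub>R v) v) = (*) (f'' (x + s *\<^sub>R v) v v)"
        by (auto simp: blinfun.scaleR_right blinfun.scaleR_left)
      ultimately show ?thesis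
        unfolding D_def by (simp add: has_field_derivative_def)
    qed
    have "DERIV (D m) s :> D (Suc m) s" if "m < 2" "0 \<le> s" "s \<le> 1" for m s
      using that D0 D1 by (cases m) (auto simp: numeral_2_eq_2)
    then obtain s where s: "0 < s" "s < 1"
      and eq: "D 0 1 = (\<Sum>m<2. D m 0 / fact m * 1 ^ m) + D 2 s / fact 2 * 1 ^ 2"
      using Maclaurin[of 1 2 D "D 0"] by auto
    let ?E = "f'' (x + s *\<^sub>R v) - f'' x"
    have "f (x + v) = f x + f' x v + f'' (x + s *\<^sub>R v) v v / 2"
      using eq by (simp add: D_def numeral_2_eq_2)
    then have "f (x + v) - f x - f' x v - f'' x v v / 2 = ?E v v / 2"
      by (simp add: blinfun.diff_left diff_divide_distrib)
    moreover have "\<bar>?E v v\<bar> \<le> e * (norm v)\<^sup>2"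
    proof -
      have "\<bar>?E v v\<bar> \<le> norm (?E v) * norm v"
        using norm_blinfun[of "?E v" v] by simp
      also have "\<dots> \<le> norm ?E * norm v * norm v"
        by (intro mult_right_mono norm_blinfun) simp
      also have "\<dots> \<le> e * norm v * norm v"
        using d1(2)[of "x + s *\<^sub>R v"] short[of s] s
        by (intro mult_right_mono) (auto simp: dist_norm)
      finally show ?thesis by (simp add: power2_eq_square mult.assoc)
    qed
    ultimately show ?thesis
      by simp
  qed
  then show thesis
    using that[of "min d1 d2"] d1(1) d2(1) by simp
qed

lemma tendsto_scaleR_at_right_0:
  "((\<lambda>(t, w'). t *\<^sub>R w') \<longlongrightarrow> (0 :: 'a::real_normed_vector)) (at_right (0::real) \<times>\<^sub>F nhds w)"
proof -
  have "((\<lambda>p. fst p *\<^sub>R snd p) \<longlongrightarrow> 0 *\<^sub>R w) (at_right (0::real) \<times>\<^sub>F nhds w)"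
    by (intro tendsto_scaleR filterlim_compose[OF _ filterlim_fst]
        filterlim_compose[OF _ filterlim_snd])
      (auto simp: filterlim_ident intro: tendsto_ident_at)
  then show ?thesis by (simp add: case_prod_unfold)
qed

lemma eventually_at_right_0_prod_pos:
  "eventually (\<lambda>(t, w'). 0 < (t::real)) (at_right 0 \<times>\<^sub>F F)"
  unfolding case_prod_unfold
  by (rule eventually_compose_filterlim[OF _ filterlim_fst]) (simp add: eventually_at_right_less)

text \<open>Directions near \<open>w\<close> have bounded norm, so a remainder of smaller order than
  \<open>norm v ^ n\<close> is also of smaller order than \<open>t ^ n\<close>, uniformly in the
  moving direction. The cases \<open>n = 1\<close> and \<open>n = 2\<close> give the two quotient
  limits below.\<close>

lemma tendsto_little_o_quotient:
  fixes R :: "'a::real_normed_vector \<Rightarrow> 'b::real_normed_vector"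
  assumes "\<And>e. e > 0 \<Longrightarrow> \<exists>d>0. \<forall>v. norm v < d \<longrightarrow> norm (R v) \<le> e * norm v ^ n"
  shows "((\<lambda>(t, w'). (1 / t ^ n) *\<^sub>R R (t *\<^sub>R w')) \<longlongrightarrow> 0) (at_right (0::real) \<times>\<^sub>F nhds w)"
proof (rule tendstoI)
  fix e :: real assume "e > 0"
  define M where "M = norm w + 1"
  have "M > 0" unfolding M_def by (simp add: add_nonneg_pos)
  \<comment> \<open>The factor \<open>M ^ n\<close> absorbs \<open>norm w' ^ n\<close>; the factor 2
    makes the final estimate strict.\<close>
  then have "e / (2 * M ^ n) > 0" using \<open>e > 0\<close> by simp
  then obtain d where d: "d > 0" "\<And>v. norm v < d \<Longrightarrow> norm (R v) \<le> e / (2 * M ^ n) * norm v ^ n"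
    using assms by blast
  have "eventually (\<lambda>p. norm (fst p *\<^sub>R snd p) < d) (at_right 0 \<times>\<^sub>F nhds w)"
    using tendstoD[OF tendsto_scaleR_at_right_0 \<open>d > 0\<close>] by (simp add: case_prod_unfold)
  moreover have "eventually (\<lambda>p. 0 < fst p) (at_right (0::real) \<times>\<^sub>F nhds w)"
    using eventually_at_right_0_prod_pos by (simp add: case_prod_unfold)
  moreover have "eventually (\<lambda>p. norm (snd p) < M) (at_right (0::real) \<times>\<^sub>F nhds w)"
    by (rule order_tendstoD(2)[OF tendsto_norm[OF filterlim_snd]]) (simp add: M_def)
  ultimately show "eventually (\<lambda>p. dist (case p of (t, w') \<Rightarrow> (1 / t ^ n) *\<^sub>R R (t *\<^sub>R w')) 0 < e)
      (at_right 0 \<times>\<^sub>F nhds w)"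
  proof eventually_elim
    case (elim p)
    obtain t w' where p: "p = (t, w')" by (rule prod.exhaust)
    have t: "t > 0" using elim p by simp
    have "norm ((1 / t ^ n) *\<^sub>R R (t *\<^sub>R w')) = (1 / t ^ n) * norm (R (t *\<^sub>R w'))"
      using t by simp
    also have "\<dots> \<le> (1 / t ^ n) * (e / (2 * M ^ n) * norm (t *\<^sub>R w') ^ n)"
      using d(2)[of "t *\<^sub>R w'"] elim p t by (intro mult_left_mono) auto
    also have "\<dots> = e / (2 * M ^ n) * norm w' ^ n"
      using t by (simp add: power_mult_distrib)
    also have "\<dots> \<le> e / (2 * M ^ n) * M ^ n"
      using elim p \<open>e > 0\<close> \<open>M > 0\<close> by (intro mult_left_mono power_mono) auto
    also have "\<dots> < e"
      using \<open>e > 0\<close> \<open>M > 0\<close> by simp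
    finally show ?case by (simp add: p)
  qed
qed

text \<open>The direction may vary together with \<open>t\<close>. This is needed because the
  directions extracted later from violating points are only convergent, not constant.\<close>

lemma has_derivative_difference_quotient:
  assumes "(f has_derivative f') (at x)"
  shows "((\<lambda>(t, w'). (1 / t) *\<^sub>R (f (x + t *\<^sub>R w') - f x)) \<longlongrightarrow> f' w)
    (at_right (0::real) \<times>\<^sub>F nhds w)"
proof -
  have bl: "bounded_linear f'"
    using assms by (rule has_derivative_bounded_linear)
  interpret linear f'
    using assms by (rule has_derivative_linear)
  define R where "R v = f (x + v) - f x - f' v" for v
  have "\<exists>d>0. \<forall>v. norm v < d \<longrightarrow> norm (R v) \<le> e * norm v ^ 1" if e: "e > 0" for e
  proof -
    obtain d where "d > 0" "\<And>y. norm (y - x) < d \<Longrightarrow> norm (f y - f x - f' (y - x)) \<le> e * norm (y - x)"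
      using assms e unfolding has_derivative_at_alt by blast
    then show ?thesis
      unfolding R_def by (metis add_diff_cancel_left' power_one_right)
  qed
  from tendsto_little_o_quotient[OF this]
  have "((\<lambda>(t, w'). (1 / t ^ 1) *\<^sub>R R (t *\<^sub>R w')) \<longlongrightarrow> 0) (at_right (0::real) \<times>\<^sub>F nhds w)" .
  moreover have "((\<lambda>p. f' (snd p)) \<longlongrightarrow> f' w) (at_right (0::real) \<times>\<^sub>F nhds w)"
    by (rule bounded_linear.tendsto[OF bl filterlim_snd])
  ultimately have lim: "((\<lambda>p. (1 / fst p ^ 1) *\<^sub>R R (fst p *\<^sub>R snd p) + f' (snd p)) \<longlongrightarrow> 0 + f' w)
      (at_right (0::real) \<times>\<^sub>F nhds w)"
    by (intro tendsto_add) (simp_all add: case_prod_unfold)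
  have "eventually (\<lambda>p. 0 < fst p) (at_right (0::real) \<times>\<^sub>F nhds w)"
    using eventually_at_right_0_prod_pos by (simp add: case_prod_unfold)
  then have "eventually (\<lambda>p. (1 / fst p ^ 1) *\<^sub>R R (fst p *\<^sub>R snd p) + f' (snd p) =
      (case p of (t, w') \<Rightarrow> (1 / t) *\<^sub>R (f (x + t *\<^sub>R w') - f x))) (at_right (0::real) \<times>\<^sub>F nhds w)"
    by eventually_elim (auto simp: R_def scale scaleR_diff_right)
  from Lim_transform_eventually[OF lim this] show ?thesis
    by simp
qed

text \<open>For a C2 function the lower limit in the second subderivative, taken at the gradient, is
  a full limit. The proof also identifies \<open>hessian\<close>, the derivative of the gradient,
  with the bilinear form given by \<open>f''\<close>.\<close>

lemma C2_around_second_order_quotient: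
  fixes f :: "'a::euclidean_space \<Rightarrow> real"
  assumes "C2_around f x"
  shows "((\<lambda>(t, w'). (f (x + t *\<^sub>R w') - f x - t * (gradient f x \<bullet> w')) / (t\<^sup>2 / 2))
    \<longlongrightarrow> hessian f x w \<bullet> w) (at_right (0::real) \<times>\<^sub>F nhds w)"
proof -
  obtain U f' f'' where U: "open U" "x \<in> U"
    and f': "\<And>y. y \<in> U \<Longrightarrow> (f has_derivative blinfun_apply (f' y)) (at y)"
    and f'': "\<And>y. y \<in> U \<Longrightarrow> (f' has_derivative blinfun_apply (f'' y)) (at y)"
    and cont: "continuous_on U f''"
    using assms unfolding C2_around_def by blast
  have grad: "gradient f y = (\<Sum>b\<in>Basis. f' y b *\<^sub>R b)" if "y \<in> U" for y
    using f'[OF that] by (intro gradient_eqI has_derivative_imp_gderiv)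
  have inner_sum: "(\<Sum>b\<in>Basis. blinfun_apply A b *\<^sub>R b) \<bullet> w = A w" for A :: "'a \<Rightarrow>\<^sub>L real" and w
  proof -
    have "A w = A (\<Sum>b\<in>Basis. (w \<bullet> b) *\<^sub>R b)"
      by (simp add: euclidean_representation)
    also have "\<dots> = (\<Sum>b\<in>Basis. blinfun_apply A b *\<^sub>R b) \<bullet> w"
      by (simp add: blinfun.sum_right blinfun.scaleR_right inner_sum_left inner_commute[of w] mult.commute)
    finally show ?thesis by simp
  qed
  have "((\<lambda>y. \<Sum>b\<in>Basis. f' y b *\<^sub>R b) has_derivative (\<lambda>h. \<Sum>b\<in>Basis. f'' x h b *\<^sub>R b)) (at x)"
    by (intro has_derivative_sum has_derivative_scaleR_left
        bounded_linear.has_derivative[OF blinfun.bounded_linear_left f''[OF U(2)]])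
  \<comment> \<open>The coordinate formula for the gradient holds throughout the open set
    \<open>U\<close>, so its derivative at \<open>x\<close> carries over.\<close>
  then have "(gradient f has_derivative (\<lambda>h. \<Sum>b\<in>Basis. f'' x h b *\<^sub>R b)) (at x)"
    by (rule has_derivative_transform_within_open[OF _ U]) (simp add: grad)
  then have hess: "hessian f x w \<bullet> w = f'' x w w"
    unfolding hessian_def by (simp add: frechet_derivative_at[symmetric] inner_sum)
  define R where "R v = f (x + v) - f x - f' x v - f'' x v v / 2" for v
  have "\<exists>d>0. \<forall>v. norm v < d \<longrightarrow> norm (R v) \<le> e * norm v ^ 2" if e: "e > 0" for e
  proof -
    obtain d where "d > 0" "\<And>v. norm v < d \<Longrightarrow> \<bar>f (x + v) - f x - f' x v - f'' x v v / 2\<bar> \<le> e * (norm v)\<^sup>2"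
      using second_order_taylor[OF U f' f'' cont e] by metis
    then show ?thesis
      unfolding R_def real_norm_def by blast
  qed
  from tendsto_little_o_quotient[OF this]
  have "((\<lambda>(t, w'). (1 / t ^ 2) *\<^sub>R R (t *\<^sub>R w')) \<longlongrightarrow> 0) (at_right (0::real) \<times>\<^sub>F nhds w)" .
  moreover have "((\<lambda>p. f'' x (snd p) (snd p)) \<longlongrightarrow> f'' x w w) (at_right (0::real) \<times>\<^sub>F nhds w)"
    by (intro blinfun.tendsto tendsto_const filterlim_snd)
  \<comment> \<open>The factor 2 accounts for dividing by \<open>t\<^sup>2 / 2\<close> instead of
    \<open>t\<^sup>2\<close>.\<close>
  ultimately have lim: "((\<lambda>p. 2 * ((1 / fst p ^ 2) *\<^sub>R R (fst p *\<^sub>R snd p)) + f'' x (snd p) (snd p))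
      \<longlongrightarrow> 2 * 0 + f'' x w w) (at_right (0::real) \<times>\<^sub>F nhds w)"
    by (intro tendsto_add tendsto_mult tendsto_const) (simp_all add: case_prod_unfold)
  have "eventually (\<lambda>p. 0 < fst p) (at_right (0::real) \<times>\<^sub>F nhds w)"
    using eventually_at_right_0_prod_pos by (simp add: case_prod_unfold)
  then have "eventually (\<lambda>p. 2 * ((1 / fst p ^ 2) *\<^sub>R R (fst p *\<^sub>R snd p)) + f'' x (snd p) (snd p) =
      (case p of (t, w') \<Rightarrow> (f (x + t *\<^sub>R w') - f x - t * (gradient f x \<bullet> w')) / (t\<^sup>2 / 2)))
      (at_right (0::real) \<times>\<^sub>F nhds w)"
    by eventually_elim
      (auto simp: R_def grad[OF U(2)] inner_sum blinfun.scaleR_right blinfun.scaleR_left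
        field_simps power2_eq_square)
  from Lim_transform_eventually[OF lim this] show ?thesis
    by (simp add: hess)
qed

text \<open>This turns the stationarity equation into a vanishing gradient of the Lagrangian, so its
  second-order quotients have no linear term.\<close>

lemma gradient_lagrangian:
  fixes f :: "'a::euclidean_space \<Rightarrow> real" and \<Phi> :: "'a \<Rightarrow> 'b::euclidean_space"
  assumes "(f has_derivative f') (at x)" "(\<Phi> has_derivative \<Phi>') (at x)"
  shows "gradient (\<lambda>x. lagrangian f \<Phi> x \<mu>) x = gradient f x + adjoint \<Phi>' \<mu>"
proof (rule gradient_eqI)
  have "GDERIV f x :> gradient f x"
    using has_derivative_imp_gderiv[OF assms(1)] gradient_eqI by metis
  moreover have "((\<lambda>x. \<mu> \<bullet> \<Phi> x) has_derivative (\<lambda>h. \<mu> \<bullet> \<Phi>' h)) (at x)"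
    by (rule has_derivative_inner_right[OF assms(2)])
  moreover have "(\<lambda>h. \<mu> \<bullet> \<Phi>' h) = (\<lambda>h. h \<bullet> adjoint \<Phi>' \<mu>)"
    using adjoint_works[OF has_derivative_linear[OF assms(2)]] by (metis inner_commute)
  ultimately show "GDERIV (\<lambda>x. lagrangian f \<Phi> x \<mu>) x :> gradient f x + adjoint \<Phi>' \<mu>"
    unfolding lagrangian_def by (intro GDERIV_add) (simp_all add: gderiv_def)
qed

section \<open>Second subderivatives and quadratic growth\<close>

lemma second_subderivative_ereal:
  "second_subderivative (\<lambda>x. ereal (\<phi> x)) x v w =
    Liminf (at_right 0 \<times>\<^sub>F nhds w)
      (\<lambda>(t, w'). ereal ((\<phi> (x + t *\<^sub>R w') - \<phi> x - t * (v \<bullet> w')) / (t\<^sup>2 / 2)))"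
  unfolding second_subderivative_def
  by (rule Liminf_eq, rule eventually_mono[OF eventually_at_right_0_prod_pos]) auto

text \<open>At feasible points only the linear term survives; at infeasible ones the infinite value
  absorbs it.\<close>

lemma second_subderivative_ind_fun:
  assumes "z \<in> \<Omega>"
  shows "second_subderivative (ind_fun \<Omega>) z v w =
    Liminf (at_right 0 \<times>\<^sub>F nhds w)
      (\<lambda>(t, w'). if z + t *\<^sub>R w' \<in> \<Omega> then ereal (- 2 * (v \<bullet> w') / t) else \<infinity>)"
  unfolding second_subderivative_def
  by (rule Liminf_eq, rule eventually_mono[OF eventually_at_right_0_prod_pos])
    (auto simp: ind_fun_def assms zero_ereal_def power2_eq_square field_simps)

text \<open>Compactness of the unit sphere. The conclusion is phrased with the filter of the second
  subderivative, so that limits and eventual properties along that filter can be pulled back to the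
  sequence.\<close>

lemma direction_subsequence:
  fixes X :: "nat \<Rightarrow> 'a::euclidean_space"
  assumes "X \<longlonglongrightarrow> a" "\<And>k. X k \<noteq> a"
  obtains r w where "strict_mono r" "norm w = 1"
    "filterlim (\<lambda>k. (norm (X (r k) - a), (1 / norm (X (r k) - a)) *\<^sub>R (X (r k) - a)))
      (at_right 0 \<times>\<^sub>F nhds w) sequentially"
proof -
  define v where "v k = (1 / norm (X k - a)) *\<^sub>R (X k - a)" for k
  have v: "v k \<in> sphere 0 1" for k
    using assms(2) by (simp add: v_def)
  obtain w r where r: "w \<in> sphere 0 1" "strict_mono r" "(v \<circ> r) \<longlonglongrightarrow> w"
    using compact_sphere[of "0::'a" 1] v unfolding compact_def by metis
  have "(\<lambda>k. norm (X (r k) - a)) \<longlonglongrightarrow> 0"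
    using LIMSEQ_subseq_LIMSEQ[OF assms(1) r(2)] by (simp add: o_def LIM_zero tendsto_norm_zero)
  then have "filterlim (\<lambda>k. norm (X (r k) - a)) (at_right 0) sequentially"
    using assms(2) by (intro tendsto_imp_filterlim_at_right) auto
  with r(3) have "filterlim (\<lambda>k. (norm (X (r k) - a), v (r k))) (at_right 0 \<times>\<^sub>F nhds w) sequentially"
    by (intro filterlim_Pair) (simp_all add: o_def)
  then show thesis
    using that r(1,2) by (simp add: v_def)
qed

lemma quadratic_growth_iff_second_subderivative_pos:
  fixes \<phi> :: "'a::euclidean_space \<Rightarrow> real"
  shows "(\<forall>w. w \<noteq> 0 \<longrightarrow> second_subderivative (\<lambda>x. ereal (\<phi> x)) x 0 w > 0) \<longleftrightarrow>
    (\<exists>\<gamma>>0. \<exists>l>0. \<forall>y\<in>cball x \<gamma>. \<phi> y \<ge> \<phi> x + l * (norm (y - x))\<^sup>2)" (is "?P \<longleftrightarrow> ?G")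
proof
  assume P: ?P
  show ?G
  proof (rule ccontr)
    assume "\<not> ?G"
    \<comment> \<open>Radius and growth constant shrink together, so a single sequence defeats every
      pair of constants.\<close>
    have "\<exists>y\<in>cball x (1 / real (Suc k)). \<phi> y < \<phi> x + 1 / real (Suc k) * (norm (y - x))\<^sup>2" for k
    proof (rule ccontr)
      assume "\<not> ?thesis"
      then have "\<forall>y\<in>cball x (1 / real (Suc k)). \<phi> y \<ge> \<phi> x + 1 / real (Suc k) * (norm (y - x))\<^sup>2"
        by (simp only: bex_simps not_less)
      moreover have "1 / real (Suc k) > 0" by simp
      ultimately have ?G
        by (intro exI[of _ "1 / real (Suc k)"] conjI)
      with \<open>\<not> ?G\<close> show False by contradiction
    qed
    then obtain X where X: "\<And>k. X k \<in> cball x (1 / real (Suc k))"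
      "\<And>k. \<phi> (X k) < \<phi> x + 1 / real (Suc k) * (norm (X k - x))\<^sup>2"
      by metis
    \<comment> \<open>The violation is strict, whereas both sides coincide at
      \<open>x\<close>.\<close>
    have ne: "X k \<noteq> x" for k using X(2)[of k] by auto
    have "(\<lambda>k. dist (X k) x) \<longlonglongrightarrow> 0"
      by (rule Lim_null_comparison[OF _ LIMSEQ_Suc[OF lim_1_over_n]])
        (use X(1) in \<open>simp add: dist_commute\<close>)
    then have "X \<longlonglongrightarrow> x" by (rule tendsto_dist_iff[THEN iffD2])
    from direction_subsequence[OF this ne] obtain r w where r: "strict_mono r" "norm w = 1"
      and lim: "filterlim (\<lambda>k. (norm (X (r k) - x), (1 / norm (X (r k) - x)) *\<^sub>R (X (r k) - x)))
        (at_right 0 \<times>\<^sub>F nhds w) sequentially" by blast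
    from r(2) have "w \<noteq> 0" by auto
    with P have "second_subderivative (\<lambda>x. ereal (\<phi> x)) x 0 w > 0" by blast
    \<comment> \<open>The second subderivative may be infinite, so a positive real below it is
      used.\<close>
    then obtain c where c: "0 < ereal c" "ereal c < second_subderivative (\<lambda>x. ereal (\<phi> x)) x 0 w"
      using ereal_dense2 by blast
    have "eventually (\<lambda>p. c < (\<phi> (x + fst p *\<^sub>R snd p) - \<phi> x) / ((fst p)\<^sup>2 / 2)) (at_right 0 \<times>\<^sub>F nhds w)"
      using less_LiminfD[OF c(2)[unfolded second_subderivative_ereal]]
      by (simp add: case_prod_unfold)
    from eventually_compose_filterlim[OF this lim]
    have "eventually (\<lambda>k. c < (\<phi> (X (r k)) - \<phi> x) / ((norm (X (r k) - x))\<^sup>2 / 2)) sequentially"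
      using ne by simp
    \<comment> \<open>The violated growth bounds the quotient by a null sequence, which no positive
      \<open>c\<close> can stay below.\<close>
    then have "eventually (\<lambda>k. c \<le> 2 * (1 / real (Suc (r k)))) sequentially"
    proof eventually_elim
      case (elim k)
      have "(\<phi> (X (r k)) - \<phi> x) / ((norm (X (r k) - x))\<^sup>2 / 2) < 2 * (1 / real (Suc (r k)))"
      proof (subst pos_divide_less_eq)
        show "\<phi> (X (r k)) - \<phi> x < 2 * (1 / real (Suc (r k))) * ((norm (X (r k) - x))\<^sup>2 / 2)"
        proof -
          have "2 * a * (b / 2) = a * b" for a b :: real
            by simp
          then show ?thesis
            using X(2)[of "r k"] by (simp only: diff_less_eq add.commute)
        qed
      qed (simp add: ne)
      with elim show ?case by simp
    qed
    moreover have "(\<lambda>k. 2 * (1 / real (Suc (r k)))) \<longlonglongrightarrow> 2 * 0"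
      using LIMSEQ_subseq_LIMSEQ[OF LIMSEQ_Suc[OF lim_1_over_n] r(1)]
      by (intro tendsto_mult tendsto_const) (simp add: o_def)
    ultimately have "c \<le> 0"
      using tendsto_lowerbound[of "\<lambda>k. 2 * (1 / real (Suc (r k)))" _ sequentially c] by simp
    with c(1) show False by simp
  qed
next
  assume ?G
  then obtain g l where g: "g > 0" and l: "l > 0"
    and G: "\<And>y. y \<in> cball x g \<Longrightarrow> \<phi> y \<ge> \<phi> x + l * (norm (y - x))\<^sup>2"
    by blast
  show ?P
  proof (intro allI impI)
    fix w :: 'a assume "w \<noteq> 0"
    have "eventually (\<lambda>p. norm (fst p *\<^sub>R snd p) < g) (at_right 0 \<times>\<^sub>F nhds w)"
      using tendstoD[OF tendsto_scaleR_at_right_0 g] by (simp add: case_prod_unfold)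
    moreover have "eventually (\<lambda>p. 0 < fst p) (at_right (0::real) \<times>\<^sub>F nhds w)"
      using eventually_at_right_0_prod_pos by (simp add: case_prod_unfold)
    moreover have "eventually (\<lambda>p. norm w / 2 < norm (snd p)) (at_right (0::real) \<times>\<^sub>F nhds w)"
      by (rule order_tendstoD(1)[OF tendsto_norm[OF filterlim_snd]]) (simp add: \<open>w \<noteq> 0\<close>)
    \<comment> \<open>Growth bounds the quotient below by \<open>2 * l * (norm w')\<^sup>2\<close>;
      the eventual bound \<open>norm w' > norm w / 2\<close> makes this a positive constant.\<close>
    ultimately have "eventually (\<lambda>p. ereal (2 * l * (norm w / 2)\<^sup>2) \<le>
        (case p of (t, w') \<Rightarrow> ereal ((\<phi> (x + t *\<^sub>R w') - \<phi> x - t * (0 \<bullet> w')) / (t\<^sup>2 / 2))))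
        (at_right 0 \<times>\<^sub>F nhds w)"
    proof eventually_elim
      case (elim p)
      obtain t w' where p: "p = (t, w')" by (rule prod.exhaust)
      have t: "t > 0" using elim p by simp
      have "2 * l * (norm w / 2)\<^sup>2 \<le> 2 * l * (norm w')\<^sup>2"
        using elim p l by (intro mult_left_mono power_mono) auto
      also have "\<dots> = l * (norm (t *\<^sub>R w'))\<^sup>2 / (t\<^sup>2 / 2)"
        using t by (simp add: power_mult_distrib)
      also have "\<dots> \<le> (\<phi> (x + t *\<^sub>R w') - \<phi> x) / (t\<^sup>2 / 2)"
        using G[of "x + t *\<^sub>R w'"] elim p by (intro divide_right_mono) (auto simp: dist_norm)
      finally show ?case by (simp add: p)
    qed
    then have "ereal (2 * l * (norm w / 2)\<^sup>2) \<le> second_subderivative (\<lambda>x. ereal (\<phi> x)) x 0 w"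
      unfolding second_subderivative_ereal by (rule Liminf_bounded)
    moreover have "0 < ereal (2 * l * (norm w / 2)\<^sup>2)"
      using l \<open>w \<noteq> 0\<close> by simp
    ultimately show "second_subderivative (\<lambda>x. ereal (\<phi> x)) x 0 w > 0"
      by (rule less_le_trans[rotated])
  qed
qed

section \<open>The augmented Lagrangian as a minimum over the cone\<close>

lemma closed_second_order_cone: "closed (second_order_cone :: (real \<times> (real ^ 'm)) set)"
proof -
  have "second_order_cone = {y :: real \<times> (real ^ 'm). norm (snd y) \<le> fst y}"
    unfolding second_order_cone_def by auto
  moreover have "closed {y :: real \<times> (real ^ 'm). norm (snd y) \<le> fst y}"
    by (intro closed_Collect_le continuous_intros)
  ultimately show ?thesis by simp
qed

lemma aug_lagrangian_term_eq:
  fixes y z \<mu> :: "'a::real_inner"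
  assumes "\<rho> > 0"
  shows "\<rho> / 2 * (dist (y + inverse \<rho> *\<^sub>R \<mu>) z)\<^sup>2 - 1 / 2 * inverse \<rho> * (norm \<mu>)\<^sup>2 =
    \<mu> \<bullet> y - \<mu> \<bullet> z + \<rho> / 2 * (norm (y - z))\<^sup>2"
proof -
  have "(dist (y + inverse \<rho> *\<^sub>R \<mu>) z)\<^sup>2 = (norm ((y - z) + inverse \<rho> *\<^sub>R \<mu>))\<^sup>2"
    by (simp add: dist_norm algebra_simps)
  also have "\<dots> = (norm (y - z))\<^sup>2 + 2 * inverse \<rho> * (\<mu> \<bullet> y - \<mu> \<bullet> z) + (inverse \<rho>)\<^sup>2 * (norm \<mu>)\<^sup>2"
    unfolding power2_norm_eq_inner
    by (simp add: inner_add inner_diff inner_commute power2_eq_square algebra_simps)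
  finally show ?thesis
    using assms by (simp add: field_simps power2_eq_square)
qed

lemma aug_lagrangian_le:
  assumes "\<rho> > 0" "z \<in> second_order_cone"
  shows "aug_lagrangian f \<Phi> x \<mu> \<rho> \<le> lagrangian f \<Phi> x \<mu> - \<mu> \<bullet> z + \<rho> / 2 * (norm (\<Phi> x - z))\<^sup>2"
proof -
  let ?y = "\<Phi> x + inverse \<rho> *\<^sub>R \<mu>"
  have "\<rho> / 2 * (infdist ?y second_order_cone)\<^sup>2 \<le> \<rho> / 2 * (dist ?y z)\<^sup>2"
    using assms by (intro mult_left_mono power_mono infdist_le infdist_nonneg) auto
  then show ?thesis
    using aug_lagrangian_term_eq[OF assms(1), of "\<Phi> x" \<mu> z]
    unfolding aug_lagrangian_def lagrangian_def by linarith
qed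

text \<open>The closed nonempty cone contains a nearest point to the shifted value of
  \<open>\<Phi>\<close>. With \<open>aug_lagrangian_le\<close> this gives the minimum
  formula.\<close>

lemma aug_lagrangian_attained:
  assumes "\<rho> > 0"
  obtains z where "z \<in> second_order_cone"
    "aug_lagrangian f \<Phi> x \<mu> \<rho> = lagrangian f \<Phi> x \<mu> - \<mu> \<bullet> z + \<rho> / 2 * (norm (\<Phi> x - z))\<^sup>2"
proof -
  let ?y = "\<Phi> x + inverse \<rho> *\<^sub>R \<mu>"
  have "0 \<in> second_order_cone"
    by (simp add: second_order_cone_def zero_prod_def)
  then obtain z where z: "z \<in> second_order_cone" "infdist ?y second_order_cone = dist ?y z"
    using infdist_attains_inf[OF closed_second_order_cone] by blast
  then have "aug_lagrangian f \<Phi> x \<mu> \<rho> = lagrangian f \<Phi> x \<mu> - \<mu> \<bullet> z + \<rho> / 2 * (norm (\<Phi> x - z))\<^sup>2"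
    using aug_lagrangian_term_eq[OF assms, of "\<Phi> x" \<mu> z]
    unfolding aug_lagrangian_def lagrangian_def by simp
  with z(1) show thesis by (rule that)
qed

text \<open>The minimiser for the larger parameter is admissible for the smaller one and has no
  larger penalty there.\<close>

lemma aug_lagrangian_mono:
  assumes "0 < \<rho>" "\<rho> \<le> \<rho>'"
  shows "aug_lagrangian f \<Phi> x \<mu> \<rho> \<le> aug_lagrangian f \<Phi> x \<mu> \<rho>'"
proof -
  have "\<rho>' > 0" using assms by simp
  then obtain z where z: "z \<in> second_order_cone"
    "aug_lagrangian f \<Phi> x \<mu> \<rho>' = lagrangian f \<Phi> x \<mu> - \<mu> \<bullet> z + \<rho>' / 2 * (norm (\<Phi> x - z))\<^sup>2"
    by (rule aug_lagrangian_attained)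
  have "\<rho> / 2 * (norm (\<Phi> x - z))\<^sup>2 \<le> \<rho>' / 2 * (norm (\<Phi> x - z))\<^sup>2"
    using assms(2) by (intro mult_right_mono) auto
  then show ?thesis
    using aug_lagrangian_le[OF assms(1) z(1), of f \<Phi> x \<mu>] z(2) by linarith
qed

text \<open>Choosing \<open>z = \<Phi> x\<close> gives the upper bound. Normality makes
  \<open>- \<mu> \<bullet> (z - \<Phi> x)\<close> nonnegative for every \<open>z\<close> in the
  cone, which gives the lower one.\<close>

lemma aug_lagrangian_normal_cone:
  assumes "\<mu> \<in> normal_cone second_order_cone (\<Phi> x)" "\<rho> > 0"
  shows "aug_lagrangian f \<Phi> x \<mu> \<rho> = f x"
proof (rule antisym)
  have "\<Phi> x \<in> second_order_cone" using assms(1) by (simp add: normal_cone_def)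
  from aug_lagrangian_le[OF assms(2) this, of f \<Phi> x \<mu>]
  show "aug_lagrangian f \<Phi> x \<mu> \<rho> \<le> f x" by (simp add: lagrangian_def)
  obtain z where z: "z \<in> second_order_cone"
    "aug_lagrangian f \<Phi> x \<mu> \<rho> = lagrangian f \<Phi> x \<mu> - \<mu> \<bullet> z + \<rho> / 2 * (norm (\<Phi> x - z))\<^sup>2"
    using assms(2) by (rule aug_lagrangian_attained)
  have "\<mu> \<bullet> (z - \<Phi> x) \<le> 0" using assms(1) z(1) by (simp add: normal_cone_def)
  moreover have "\<rho> / 2 * (norm (\<Phi> x - z))\<^sup>2 \<ge> 0" using assms(2) by simp
  ultimately show "f x \<le> aug_lagrangian f \<Phi> x \<mu> \<rho>"
    unfolding z(2) lagrangian_def inner_diff_right by linarith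
qed

section \<open>Quadratic growth against the second-order sufficient condition\<close>

text \<open>Growth at one fixed parameter suffices, and the inequality is obtained for every nonzero
  \<open>w\<close>, critical or not.\<close>

lemma second_order_sufficiency_if_growth:
  fixes f :: "real ^ 'n \<Rightarrow> real"
    and \<Phi> :: "real ^ 'n \<Rightarrow> real \<times> (real ^ 'm)"
  defines "L \<equiv> \<lambda>\<mu> x. lagrangian f \<Phi> x \<mu>"
  assumes L: "C2_around (L \<mu>) x" and grad: "gradient (L \<mu>) x = 0"
    and \<Phi>': "(\<Phi> has_derivative \<Phi>') (at x)"
    and y: "\<Phi> x \<in> second_order_cone"
    and "\<rho> > 0" "\<gamma> > 0" "l > 0"
    and growth: "\<And>x'. x' \<in> cball x \<gamma> \<Longrightarrow>
      aug_lagrangian f \<Phi> x' \<mu> \<rho> \<ge> f x + l * (norm (x' - x))\<^sup>2"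
    and "w \<noteq> 0"
  shows "ereal (hessian (L \<mu>) x w \<bullet> w)
    + second_subderivative (ind_fun second_order_cone) (\<Phi> x) \<mu> (\<Phi>' w) > 0"
proof -
  let ?F = "at_right (0::real) \<times>\<^sub>F nhds (\<Phi>' w)"
  let ?h = "hessian (L \<mu>) x w \<bullet> w"
  define q where "q t = (L \<mu> (x + t *\<^sub>R w) - L \<mu> x) / (t\<^sup>2 / 2)" for t :: real
  define d where "d t = (1 / t) *\<^sub>R (\<Phi> (x + t *\<^sub>R w) - \<Phi> x)" for t :: real
  \<comment> \<open>Freezing the direction at \<open>w\<close> transports limits to the filter
    around \<open>\<Phi>' w\<close>, in which the step \<open>t\<close> is shared and the cone
    direction \<open>u\<close> moves.\<close>
  have dir: "filterlim (\<lambda>p. (fst p, w)) (at_right 0 \<times>\<^sub>F nhds w) ?F"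
    by (intro filterlim_Pair filterlim_fst tendsto_const)
  have q: "((\<lambda>p. q (fst p)) \<longlongrightarrow> ?h) ?F"
    using filterlim_compose[OF C2_around_second_order_quotient[OF L] dir]
    by (simp add: q_def grad)
  have d: "((\<lambda>p. d (fst p)) \<longlongrightarrow> \<Phi>' w) ?F"
    using filterlim_compose[OF has_derivative_difference_quotient[OF \<Phi>'] dir]
    by (simp add: d_def)
  \<comment> \<open>This is the growth inequality divided by \<open>t\<^sup>2 / 2\<close> and solved
    for the quotient of the indicator function. The penalty vanishes in the limit for fixed
    \<open>\<rho>\<close>, because \<open>d t\<close> and \<open>u\<close> both tend to
    \<open>\<Phi>' w\<close>.\<close>
  have "((\<lambda>p. 2 * l * (norm w)\<^sup>2 - q (fst p) - \<rho> * (norm (d (fst p) - snd p))\<^sup>2) \<longlongrightarrow>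
      2 * l * (norm w)\<^sup>2 - ?h - \<rho> * (norm (\<Phi>' w - \<Phi>' w))\<^sup>2) ?F"
    by (intro tendsto_diff tendsto_mult tendsto_power tendsto_norm tendsto_const q d filterlim_snd)
  then have "((\<lambda>p. ereal (2 * l * (norm w)\<^sup>2 - q (fst p) - \<rho> * (norm (d (fst p) - snd p))\<^sup>2)) \<longlongrightarrow>
      ereal (2 * l * (norm w)\<^sup>2 - ?h)) ?F"
    by simp
  moreover have nontriv: "?F \<noteq> bot"
    by (simp add: prod_filter_eq_bot)
  ultimately have "ereal (2 * l * (norm w)\<^sup>2 - ?h) =
      Liminf ?F (\<lambda>p. ereal (2 * l * (norm w)\<^sup>2 - q (fst p) - \<rho> * (norm (d (fst p) - snd p))\<^sup>2))"
    by (intro lim_imp_Liminf[symmetric])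
  also have "\<dots> \<le> second_subderivative (ind_fun second_order_cone) (\<Phi> x) \<mu> (\<Phi>' w)"
    unfolding second_subderivative_ind_fun[OF y]
  proof (rule Liminf_mono)
    have "((\<lambda>p. fst p *\<^sub>R w) \<longlongrightarrow> 0) ?F"
      using filterlim_compose[OF tendsto_scaleR_at_right_0 dir] by simp
    from tendstoD[OF this \<open>\<gamma> > 0\<close>] have "eventually (\<lambda>p. norm (fst p *\<^sub>R w) < \<gamma>) ?F"
      by simp
    moreover have "eventually (\<lambda>p. 0 < fst p) ?F"
      using eventually_at_right_0_prod_pos by (simp add: case_prod_unfold)
    ultimately show "eventually (\<lambda>p. ereal (2 * l * (norm w)\<^sup>2 - q (fst p)
          - \<rho> * (norm (d (fst p) - snd p))\<^sup>2)
        \<le> (case p of (t, u) \<Rightarrow> if \<Phi> x + t *\<^sub>R u \<in> second_order_cone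
            then ereal (- 2 * (\<mu> \<bullet> u) / t) else \<infinity>)) ?F"
    proof eventually_elim
      case (elim p)
      obtain t u where p: "p = (t, u)" by (rule prod.exhaust)
      have t: "t > 0" using elim p by simp
      show ?case
      proof (cases "\<Phi> x + t *\<^sub>R u \<in> second_order_cone")
        case True
        have "f x + l * (norm (t *\<^sub>R w))\<^sup>2 \<le> aug_lagrangian f \<Phi> (x + t *\<^sub>R w) \<mu> \<rho>"
          using growth[of "x + t *\<^sub>R w"] elim p by (simp add: dist_norm)
        also have "\<dots> \<le> L \<mu> (x + t *\<^sub>R w) - \<mu> \<bullet> (\<Phi> x + t *\<^sub>R u)
            + \<rho> / 2 * (norm (\<Phi> (x + t *\<^sub>R w) - (\<Phi> x + t *\<^sub>R u)))\<^sup>2"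
          unfolding L_def using \<open>\<rho> > 0\<close> True by (rule aug_lagrangian_le)
        also have "L \<mu> (x + t *\<^sub>R w) = L \<mu> x + t\<^sup>2 / 2 * q t"
        proof -
          have "t\<^sup>2 / 2 \<noteq> 0" using t by simp
          then have "t\<^sup>2 / 2 * q t = L \<mu> (x + t *\<^sub>R w) - L \<mu> x"
            unfolding q_def by (metis nonzero_eq_divide_eq mult.commute)
          then show ?thesis by linarith
        qed
        also have "\<Phi> (x + t *\<^sub>R w) - (\<Phi> x + t *\<^sub>R u) = t *\<^sub>R (d t - u)"
          using t by (simp add: d_def algebra_simps)
        finally have "l * (t\<^sup>2 * (norm w)\<^sup>2)
            \<le> t\<^sup>2 / 2 * q t - t * (\<mu> \<bullet> u) + \<rho> / 2 * (t\<^sup>2 * (norm (d t - u))\<^sup>2)"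
          by (simp add: L_def lagrangian_def power_mult_distrib inner_add_right)
        moreover have "t\<^sup>2 / 2 * (- 2 * (\<mu> \<bullet> u) / t) = - (t * (\<mu> \<bullet> u))"
          using t by (simp add: power2_eq_square)
        ultimately have "t\<^sup>2 / 2 * (2 * l * (norm w)\<^sup>2 - q t - \<rho> * (norm (d t - u))\<^sup>2)
            \<le> t\<^sup>2 / 2 * (- 2 * (\<mu> \<bullet> u) / t)"
          by (simp add: right_diff_distrib mult.commute mult.left_commute)
        then have "2 * l * (norm w)\<^sup>2 - q t - \<rho> * (norm (d t - u))\<^sup>2 \<le> - 2 * (\<mu> \<bullet> u) / t"
          using t by (subst (asm) mult_le_cancel_left_pos) auto
        then show ?thesis using True by (simp add: p)
      qed (simp add: p)
    qed
  qed
  finally have D: "ereal (2 * l * (norm w)\<^sup>2 - ?h)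
    \<le> second_subderivative (ind_fun second_order_cone) (\<Phi> x) \<mu> (\<Phi>' w)" .
  \<comment> \<open>The Hessian term is finite and cancels, leaving the growth constant as a strict
    margin.\<close>
  have "0 < ereal (2 * l * (norm w)\<^sup>2)"
    using \<open>l > 0\<close> \<open>w \<noteq> 0\<close> by simp
  also have "\<dots> = ereal ?h + ereal (2 * l * (norm w)\<^sup>2 - ?h)"
    by simp
  also have "\<dots> \<le> ereal ?h + second_subderivative (ind_fun second_order_cone) (\<Phi> x) \<mu> (\<Phi>' w)"
    using D by (rule add_left_mono)
  finally show ?thesis .
qed

lemma growth_if_second_order_sufficiency:
  fixes f :: "real ^ 'n \<Rightarrow> real"
    and \<Phi> :: "real ^ 'n \<Rightarrow> real \<times> (real ^ 'm)"
  defines "L \<equiv> \<lambda>\<mu> x. lagrangian f \<Phi> x \<mu>"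
  assumes L: "C2_around (L \<mu>) x" and grad: "gradient (L \<mu>) x = 0"
    and \<Phi>': "(\<Phi> has_derivative \<Phi>') (at x)"
    and normal: "\<mu> \<in> normal_cone second_order_cone (\<Phi> x)"
    and sosc: "\<And>w. w \<noteq> 0 \<Longrightarrow> \<Phi>' w \<in> critical_cone second_order_cone (\<Phi> x) \<mu> \<Longrightarrow>
      ereal (hessian (L \<mu>) x w \<bullet> w)
        + second_subderivative (ind_fun second_order_cone) (\<Phi> x) \<mu> (\<Phi>' w) > 0"
  shows "\<exists>\<rho>b>0. \<exists>\<gamma>>0. \<exists>l>0. \<forall>\<rho>\<ge>\<rho>b. \<forall>x'\<in>cball x \<gamma>.
    aug_lagrangian f \<Phi> x' \<mu> \<rho> \<ge> f x + l * (norm (x' - x))\<^sup>2"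
proof (rule ccontr)
  assume neg: "\<not> ?thesis"
  have y: "\<Phi> x \<in> second_order_cone" using normal by (simp add: normal_cone_def)
  \<comment> \<open>One index drives the penalty parameter to infinity and both the radius and the
    growth constant to zero.\<close>
  have "\<exists>\<rho> x'. \<rho> \<ge> real (Suc k) \<and> x' \<in> cball x (1 / real (Suc k)) \<and>
    aug_lagrangian f \<Phi> x' \<mu> \<rho> < f x + 1 / real (Suc k) * (norm (x' - x))\<^sup>2" for k
  proof (rule ccontr)
    assume "\<not> ?thesis"
    then have "\<forall>\<rho>\<ge>real (Suc k). \<forall>x'\<in>cball x (1 / real (Suc k)).
        aug_lagrangian f \<Phi> x' \<mu> \<rho> \<ge> f x + 1 / real (Suc k) * (norm (x' - x))\<^sup>2"
      by (meson not_le)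
    moreover have "real (Suc k) > 0" "1 / real (Suc k) > 0" by simp_all
    ultimately show False using neg by blast
  qed
  then obtain R X where R: "\<And>k. R k \<ge> real (Suc k)"
    and X: "\<And>k. X k \<in> cball x (1 / real (Suc k))"
    and lt: "\<And>k. aug_lagrangian f \<Phi> (X k) \<mu> (R k) < f x + 1 / real (Suc k) * (norm (X k - x))\<^sup>2"
    by metis
  have R_pos: "R k > 0" for k
    using R[of k] by (rule less_le_trans[rotated]) simp
  have ne: "X k \<noteq> x" for k
    using lt[of k] aug_lagrangian_normal_cone[of \<mu> \<Phi> x "R k" f, OF normal R_pos] by auto
  have "(\<lambda>k. dist (X k) x) \<longlonglongrightarrow> 0"
    by (rule Lim_null_comparison[OF _ LIMSEQ_Suc[OF lim_1_over_n]])
      (use X in \<open>simp add: dist_commute\<close>)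
  then have "X \<longlonglongrightarrow> x" by (rule tendsto_dist_iff[THEN iffD2])
  from direction_subsequence[OF this ne] obtain r w where r: "strict_mono r" "norm w = 1"
    and lim0: "filterlim (\<lambda>k. (norm (X (r k) - x), (1 / norm (X (r k) - x)) *\<^sub>R (X (r k) - x)))
      (at_right 0 \<times>\<^sub>F nhds w) sequentially" by blast
  define t where "t k = norm (X (r k) - x)" for k
  define v where "v k = (1 / t k) *\<^sub>R (X (r k) - x)" for k
  define \<epsilon> where "\<epsilon> k = 1 / real (Suc (r k))" for k
  have lim: "filterlim (\<lambda>k. (t k, v k)) (at_right 0 \<times>\<^sub>F nhds w) sequentially"
    using lim0 by (simp add: t_def v_def)
  have t_pos: "t k > 0" for k using ne by (simp add: t_def)
  have X_eq: "X (r k) = x + t k *\<^sub>R v k" for k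
    using t_pos[of k] by (simp add: v_def)
  have t_right: "filterlim t (at_right 0) sequentially"
    using filterlim_compose[OF filterlim_fst lim] by simp
  then have t_lim: "t \<longlonglongrightarrow> 0"
    by (simp add: filterlim_at)
  have \<epsilon>_pos: "\<epsilon> k > 0" for k by (simp add: \<epsilon>_def)
  have \<epsilon>_lim: "\<epsilon> \<longlonglongrightarrow> 0"
    using LIMSEQ_subseq_LIMSEQ[OF LIMSEQ_Suc[OF lim_1_over_n] r(1)]
    by (simp add: o_def \<epsilon>_def[abs_def])
  have "\<exists>z. z \<in> second_order_cone \<and> aug_lagrangian f \<Phi> (X (r k)) \<mu> (R (r k)) =
      L \<mu> (X (r k)) - \<mu> \<bullet> z + R (r k) / 2 * (norm (\<Phi> (X (r k)) - z))\<^sup>2" for k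
    unfolding L_def using aug_lagrangian_attained
      [OF R_pos[of "r k"], where f = f and \<Phi> = \<Phi> and x = "X (r k)" and \<mu> = \<mu>] by metis
  then obtain Z where Z: "\<And>k. Z k \<in> second_order_cone"
    and Z_eq: "\<And>k. aug_lagrangian f \<Phi> (X (r k)) \<mu> (R (r k)) =
      L \<mu> (X (r k)) - \<mu> \<bullet> Z k + R (r k) / 2 * (norm (\<Phi> (X (r k)) - Z k))\<^sup>2"
    by metis
  \<comment> \<open>Scaled by \<open>t k\<close>, \<open>u\<close> is the displacement of the
    minimiser from \<open>\<Phi> x\<close> and \<open>d\<close> is its gap to
    \<open>\<Phi> (X (r k))\<close>; their sum is the difference quotient of
    \<open>\<Phi>\<close>.\<close>
  define u where "u k = (1 / t k) *\<^sub>R (Z k - \<Phi> x)" for k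
  define d where "d k = (1 / t k) *\<^sub>R (\<Phi> (X (r k)) - Z k)" for k
  define a where "a k = (L \<mu> (x + t k *\<^sub>R v k) - L \<mu> x) / ((t k)\<^sup>2 / 2)" for k
  have Z_u: "Z k = \<Phi> x + t k *\<^sub>R u k" for k
    using t_pos[of k] by (simp add: u_def)
  have a_lim: "a \<longlonglongrightarrow> hessian (L \<mu>) x w \<bullet> w"
    using filterlim_compose[OF C2_around_second_order_quotient[OF L] lim]
    by (simp add: a_def[abs_def] grad)
  have u_nonpos: "\<mu> \<bullet> u k \<le> 0" for k
    using normal Z[of k] t_pos[of k] unfolding u_def normal_cone_def
    by (auto simp: mult_nonneg_nonpos divide_nonpos_pos)
  \<comment> \<open>This is the violated inequality divided by \<open>(t k)\<^sup>2 / 2\<close>. By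
    \<open>u_nonpos\<close> the multiplier and penalty terms are both nonnegative, so dropping
    either one bounds the other.\<close>
  have key: "a k - 2 * (\<mu> \<bullet> u k) / t k + R (r k) * (norm (d k))\<^sup>2 < 2 * \<epsilon> k" for k
  proof -
    have "L \<mu> (X (r k)) - \<mu> \<bullet> Z k + R (r k) / 2 * (norm (\<Phi> (X (r k)) - Z k))\<^sup>2
        < f x + \<epsilon> k * (t k)\<^sup>2"
      using lt[of "r k"] unfolding Z_eq by (simp add: t_def \<epsilon>_def)
    moreover have "L \<mu> (X (r k)) = L \<mu> x + (t k)\<^sup>2 / 2 * a k"
    proof -
      have "(t k)\<^sup>2 / 2 \<noteq> 0" using t_pos[of k] by simp
      then have "(t k)\<^sup>2 / 2 * a k = L \<mu> (x + t k *\<^sub>R v k) - L \<mu> x"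
        unfolding a_def by (metis nonzero_eq_divide_eq mult.commute)
      then show ?thesis by (simp only: X_eq)
    qed
    moreover have "\<Phi> (X (r k)) - Z k = t k *\<^sub>R d k"
      using t_pos[of k] by (simp add: d_def)
    ultimately have "(t k)\<^sup>2 / 2 * a k - t k * (\<mu> \<bullet> u k)
        + R (r k) / 2 * ((t k)\<^sup>2 * (norm (d k))\<^sup>2) < \<epsilon> k * (t k)\<^sup>2"
      by (simp add: Z_u L_def lagrangian_def power_mult_distrib inner_add_right)
    moreover have "(t k)\<^sup>2 / 2 * (2 * (\<mu> \<bullet> u k) / t k) = t k * (\<mu> \<bullet> u k)"
      using t_pos[of k] by (simp add: power2_eq_square)
    ultimately have "(t k)\<^sup>2 / 2 * (a k - 2 * (\<mu> \<bullet> u k) / t k + R (r k) * (norm (d k))\<^sup>2)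
        < (t k)\<^sup>2 / 2 * (2 * \<epsilon> k)"
      by (simp add: right_diff_distrib distrib_left mult.commute mult.left_commute)
    then show ?thesis
      using t_pos[of k] by (subst (asm) mult_less_cancel_left_pos) auto
  qed
  have u_bound: "- 2 * (\<mu> \<bullet> u k) / t k \<le> 2 * \<epsilon> k - a k" for k
  proof -
    have "0 \<le> R (r k) * (norm (d k))\<^sup>2"
      using R_pos[of "r k"] by simp
    then show ?thesis using key[of k] by simp
  qed
  \<comment> \<open>Since \<open>R (r k)\<close> is at least \<open>1 / \<epsilon> k\<close>, the
    bounded penalty term forces the gap \<open>d\<close> to vanish.\<close>
  have d_bound: "(norm (d k))\<^sup>2 \<le> \<epsilon> k * (2 * \<epsilon> k - a k)" for k
  proof -
    have "(norm (d k))\<^sup>2 = \<epsilon> k * (real (Suc (r k)) * (norm (d k))\<^sup>2)"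
      by (simp add: \<epsilon>_def)
    also have "\<dots> \<le> \<epsilon> k * (R (r k) * (norm (d k))\<^sup>2)"
      using R \<epsilon>_pos[of k] by (intro mult_left_mono mult_right_mono) auto
    also have "\<dots> \<le> \<epsilon> k * (2 * \<epsilon> k - a k)"
    proof -
      have "2 * (\<mu> \<bullet> u k) / t k \<le> 0"
        using u_nonpos[of k] t_pos[of k] by (simp add: divide_nonpos_pos)
      then show ?thesis
        using key[of k] \<epsilon>_pos[of k] by (intro mult_left_mono) auto
    qed
    finally show ?thesis .
  qed
  have "(\<lambda>k. \<epsilon> k * (2 * \<epsilon> k - a k)) \<longlonglongrightarrow> 0 * (2 * 0 - hessian (L \<mu>) x w \<bullet> w)"
    by (intro tendsto_mult tendsto_diff tendsto_const \<epsilon>_lim a_lim)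
  then have "(\<lambda>k. \<epsilon> k * (2 * \<epsilon> k - a k)) \<longlonglongrightarrow> 0"
    by simp
  then have "(\<lambda>k. (norm (d k))\<^sup>2) \<longlonglongrightarrow> 0"
    by (rule Lim_null_comparison[rotated]) (simp add: d_bound)
  then have "(\<lambda>k. sqrt ((norm (d k))\<^sup>2)) \<longlonglongrightarrow> sqrt 0"
    by (rule tendsto_real_sqrt)
  then have d_lim: "d \<longlonglongrightarrow> 0"
    by (simp add: tendsto_norm_zero_iff)
  have "(\<lambda>k. (1 / t k) *\<^sub>R (\<Phi> (X (r k)) - \<Phi> x) - d k) \<longlonglongrightarrow> \<Phi>' w - 0"
    using filterlim_compose[OF has_derivative_difference_quotient[OF \<Phi>'] lim] d_lim
    by (intro tendsto_diff) (simp_all add: X_eq)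
  moreover have "(1 / t k) *\<^sub>R (\<Phi> (X (r k)) - \<Phi> x) - d k = u k" for k
    by (simp add: u_def d_def algebra_simps)
  ultimately have u_lim: "u \<longlonglongrightarrow> \<Phi>' w"
    by simp
  have "\<Phi>' w \<in> tangent_cone second_order_cone (\<Phi> x)"
    unfolding tangent_cone_def using y t_pos t_lim u_lim Z Z_u by auto
  moreover have "\<mu> \<bullet> \<Phi>' w = 0"
  proof (rule antisym)
    have mu_lim: "(\<lambda>k. \<mu> \<bullet> u k) \<longlonglongrightarrow> \<mu> \<bullet> \<Phi>' w"
      by (intro tendsto_inner tendsto_const u_lim)
    show "\<mu> \<bullet> \<Phi>' w \<le> 0"
      using mu_lim u_nonpos by (intro LIMSEQ_le_const2) auto
    \<comment> \<open>Rescaling \<open>u_bound\<close> by \<open>t k / 2\<close> gives a lower bound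
      that tends to 0, since \<open>2 * \<epsilon> k - a k\<close> converges.\<close>
    have "- (t k / 2) * (2 * \<epsilon> k - a k) \<le> \<mu> \<bullet> u k" for k
      using u_bound[of k] t_pos[of k] by (simp add: field_simps)
    moreover have "(\<lambda>k. - (t k / 2) * (2 * \<epsilon> k - a k)) \<longlonglongrightarrow>
        - (0 / 2) * (2 * 0 - hessian (L \<mu>) x w \<bullet> w)"
      by (intro tendsto_mult tendsto_diff tendsto_minus tendsto_divide tendsto_const t_lim \<epsilon>_lim a_lim) simp
    ultimately show "0 \<le> \<mu> \<bullet> \<Phi>' w"
      using LIMSEQ_le[OF _ mu_lim] by simp
  qed
  ultimately have "\<Phi>' w \<in> critical_cone second_order_cone (\<Phi> x) \<mu>"
    by (simp add: critical_cone_def)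
  moreover have "w \<noteq> 0" using r(2) by auto
  ultimately have "0 < ereal (hessian (L \<mu>) x w \<bullet> w)
      + second_subderivative (ind_fun second_order_cone) (\<Phi> x) \<mu> (\<Phi>' w)"
    by (intro sosc)
  \<comment> \<open>The Hessian term is real and can be moved across; the case split covers infinite
    values of the second subderivative.\<close>
  then have "ereal (- (hessian (L \<mu>) x w \<bullet> w))
      < second_subderivative (ind_fun second_order_cone) (\<Phi> x) \<mu> (\<Phi>' w)"
    by (cases "second_subderivative (ind_fun second_order_cone) (\<Phi> x) \<mu> (\<Phi>' w)") auto
  then obtain c where c: "- (hessian (L \<mu>) x w \<bullet> w) < c"
      "ereal c < second_subderivative (ind_fun second_order_cone) (\<Phi> x) \<mu> (\<Phi>' w)"
    using ereal_dense2 by (metis less_ereal.simps(1))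
  have "filterlim (\<lambda>k. (t k, u k)) (at_right 0 \<times>\<^sub>F nhds (\<Phi>' w)) sequentially"
    by (intro filterlim_Pair t_right u_lim)
  \<comment> \<open>Along \<open>(t k, u k)\<close> the points \<open>Z k\<close> lie in the cone,
    so the finite branch of the indicator quotient applies and \<open>u_bound\<close> caps
    it.\<close>
  from eventually_compose_filterlim[OF less_LiminfD[OF c(2)[unfolded second_subderivative_ind_fun[OF y]]] this]
  have "eventually (\<lambda>k. c < - 2 * (\<mu> \<bullet> u k) / t k) sequentially"
    using Z by (simp add: Z_u[symmetric])
  then have "eventually (\<lambda>k. c \<le> 2 * \<epsilon> k - a k) sequentially"
    by eventually_elim (use u_bound in \<open>metis less_le_trans less_imp_le\<close>)
  moreover have "(\<lambda>k. 2 * \<epsilon> k - a k) \<longlonglongrightarrow> 2 * 0 - hessian (L \<mu>) x w \<bullet> w"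
    by (intro tendsto_mult tendsto_diff tendsto_const \<epsilon>_lim a_lim)
  ultimately have "c \<le> - (hessian (L \<mu>) x w \<bullet> w)"
    using tendsto_lowerbound[of "\<lambda>k. 2 * \<epsilon> k - a k" _ sequentially c] by simp
  with c(1) show False by simp
qed

section \<open>Equivalence of the three conditions\<close>

theorem theorem4p3:
  fixes f :: "real ^ 'n \<Rightarrow> real"
    and \<Phi> :: "real ^ 'n \<Rightarrow> real \<times> (real ^ 'm)"
    and xb :: "real ^ 'n"
    and lb :: "real \<times> (real ^ 'm)"
  assumes f_C2: "C2_around f xb"
    and Phi_C2: "C2_around \<Phi> xb"
    and stationarity: "gradient f xb + adjoint (frechet_derivative \<Phi> (at xb)) lb = 0"
    and normality: "lb \<in> normal_cone second_order_cone (\<Phi> xb)"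
  shows
      "((\<forall>w. w \<noteq> 0 \<and>
            frechet_derivative \<Phi> (at xb) w \<in> critical_cone second_order_cone (\<Phi> xb) lb \<longrightarrow>
          ereal (hessian (\<lambda>x. lagrangian f \<Phi> x lb) xb w \<bullet> w)
            + second_subderivative (ind_fun second_order_cone) (\<Phi> xb) lb
                (frechet_derivative \<Phi> (at xb) w) > 0)
       \<longleftrightarrow>
       (\<exists>\<rho>b>0. \<forall>\<rho>\<ge>\<rho>b. \<forall>w. w \<noteq> 0 \<longrightarrow>
          second_subderivative (\<lambda>x. ereal (aug_lagrangian f \<Phi> x lb \<rho>)) xb 0 w > 0))
       \<and>
       ((\<exists>\<rho>b>0. \<forall>\<rho>\<ge>\<rho>b. \<forall>w. w \<noteq> 0 \<longrightarrow>
          second_subderivative (\<lambda>x. ereal (aug_lagrangian f \<Phi> x lb \<rho>)) xb 0 w > 0)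
       \<longleftrightarrow>
       (\<exists>\<rho>b>0. \<exists>\<gamma>>0. \<exists>l>0. \<forall>\<rho>\<ge>\<rho>b. \<forall>x\<in>cball xb \<gamma>.
          aug_lagrangian f \<Phi> x lb \<rho> \<ge> f xb + l * (norm (x - xb))\<^sup>2))"
proof -
  let ?i = "\<forall>w. w \<noteq> 0 \<and>
      frechet_derivative \<Phi> (at xb) w \<in> critical_cone second_order_cone (\<Phi> xb) lb \<longrightarrow>
    ereal (hessian (\<lambda>x. lagrangian f \<Phi> x lb) xb w \<bullet> w)
      + second_subderivative (ind_fun second_order_cone) (\<Phi> xb) lb
          (frechet_derivative \<Phi> (at xb) w) > 0"
  let ?ii = "\<exists>\<rho>b>0. \<forall>\<rho>\<ge>\<rho>b. \<forall>w. w \<noteq> 0 \<longrightarrow>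
    second_subderivative (\<lambda>x. ereal (aug_lagrangian f \<Phi> x lb \<rho>)) xb 0 w > 0"
  let ?iii = "\<exists>\<rho>b>0. \<exists>\<gamma>>0. \<exists>l>0. \<forall>\<rho>\<ge>\<rho>b. \<forall>x\<in>cball xb \<gamma>.
    aug_lagrangian f \<Phi> x lb \<rho> \<ge> f xb + l * (norm (x - xb))\<^sup>2"
  have L: "C2_around (\<lambda>x. lagrangian f \<Phi> x lb) xb"
    using f_C2 Phi_C2 by (rule C2_around_lagrangian)
  note \<Phi>' = C2_around_imp_has_derivative[OF Phi_C2]
  have grad: "gradient (\<lambda>x. lagrangian f \<Phi> x lb) xb = 0"
    using gradient_lagrangian[OF C2_around_imp_has_derivative[OF f_C2] \<Phi>'] stationarity by simp
  have y: "\<Phi> xb \<in> second_order_cone"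
    using normality by (simp add: normal_cone_def)
  \<comment> \<open>The reference value is \<open>f xb\<close> for every positive
    \<open>\<rho>\<close>. The radius and growth constant here may still depend on
    \<open>\<rho>\<close>.\<close>
  have growth: "(\<forall>w. w \<noteq> 0 \<longrightarrow>
      second_subderivative (\<lambda>x. ereal (aug_lagrangian f \<Phi> x lb \<rho>)) xb 0 w > 0) \<longleftrightarrow>
    (\<exists>\<gamma>>0. \<exists>l>0. \<forall>x\<in>cball xb \<gamma>. aug_lagrangian f \<Phi> x lb \<rho> \<ge> f xb + l * (norm (x - xb))\<^sup>2)"
    if "\<rho> > 0" for \<rho>
    using quadratic_growth_iff_second_subderivative_pos
      [where x = xb and \<phi> = "\<lambda>x. aug_lagrangian f \<Phi> x lb \<rho>"]
    by (simp only: aug_lagrangian_normal_cone[where \<Phi> = \<Phi>, OF normality that])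
  have "?iii" if ?ii
  proof -
    from that obtain \<rho>b where \<rho>b: "\<rho>b > 0" and "\<forall>w. w \<noteq> 0 \<longrightarrow>
        second_subderivative (\<lambda>x. ereal (aug_lagrangian f \<Phi> x lb \<rho>b)) xb 0 w > 0"
      by blast
    then obtain \<gamma> l where "\<gamma> > 0" "l > 0"
      and *: "\<forall>x\<in>cball xb \<gamma>. aug_lagrangian f \<Phi> x lb \<rho>b \<ge> f xb + l * (norm (x - xb))\<^sup>2"
      using growth[OF \<rho>b] by blast
    \<comment> \<open>Monotonicity extends the constants found at \<open>\<rho>b\<close> to all
      larger parameters, which makes them uniform.\<close>
    moreover have "f xb + l * (norm (x - xb))\<^sup>2 \<le> aug_lagrangian f \<Phi> x lb \<rho>"
      if "\<rho> \<ge> \<rho>b" "x \<in> cball xb \<gamma>" for \<rho> x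
      using * that(2) aug_lagrangian_mono[OF \<rho>b that(1), of f \<Phi> x lb] order_trans by blast
    ultimately show ?thesis
      using \<rho>b by blast
  qed
  moreover have ?ii if ?iii
  proof -
    from that obtain \<rho>b \<gamma> l where \<rho>b: "\<rho>b > 0" and "\<gamma> > 0" "l > 0"
      and *: "\<forall>\<rho>\<ge>\<rho>b. \<forall>x\<in>cball xb \<gamma>. aug_lagrangian f \<Phi> x lb \<rho> \<ge> f xb + l * (norm (x - xb))\<^sup>2"
      by blast
    have "\<forall>w. w \<noteq> 0 \<longrightarrow> second_subderivative (\<lambda>x. ereal (aug_lagrangian f \<Phi> x lb \<rho>)) xb 0 w > 0"
      if "\<rho> \<ge> \<rho>b" for \<rho>
    proof -
      have "\<rho> > 0" using \<rho>b that by simp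
      from growth[OF this] show ?thesis
        using * that \<open>\<gamma> > 0\<close> \<open>l > 0\<close> by blast
    qed
    then show ?thesis using \<rho>b by blast
  qed
  moreover have ?iii if ?i
    using growth_if_second_order_sufficiency[OF L grad \<Phi>' normality] that by blast
  \<comment> \<open>Conditions (i) and (iii) are linked directly, using only the parameter
    \<open>\<rho>b\<close>.\<close>
  moreover have ?i if ?iii
  proof -
    from that obtain \<rho>b \<gamma> l where "\<rho>b > 0" "\<gamma> > 0" "l > 0"
      and "\<And>x. x \<in> cball xb \<gamma> \<Longrightarrow> aug_lagrangian f \<Phi> x lb \<rho>b \<ge> f xb + l * (norm (x - xb))\<^sup>2"
      by blast
    from second_order_sufficiency_if_growth[OF L grad \<Phi>' y this] show ?thesis
      by blast
  qed
  ultimately show ?thesis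
    by blast
qed

end
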